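(* Let $n\ge 1$ and let $\rho_n>0$ be chosen so that $m_n(2\rho_n B_2^n)=(2\pi)^{n/2}$ (that is, $\rho_n=\frac{1}{\sqrt 2}\,\Gamma\!\left(1+\frac n2\right)^{1/n}$, so that $\rho_n\sim\frac12\sqrt{n/e}$ as $n\to\infty$). Then $$\mu_n(A\cap B)\ \ge\ \mu_n(A)\,\mu_n(B)$$ for all closed, convex sets $A,B\subset\mathbb{R}^n$ which are symmetric about the origin and satisfy $A\subset\rho_n B_2^n$ and $B\subset\rho_n B_2^n$.
   Context: $\mu_n$ denotes the standard Gaussian measure on $\mathbb{R}^n$, $\mu_n(A)=(2\pi)^{-n/2}\int_A e^{-|x|^2/2}\,dx$; $m_n$ denotes Lebesgue measure on $\mathbb{R}^n$; $B_2^n=\{x\in\mathbb{R}^n:|x|\le1\}$ is the Euclidean unit ball. A set $A$ is symmetric about the origin if $A=-A$. *)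

theory Defs
  imports "HOL-Analysis.Analysis" "HOL-Library.Landau_Symbols"
begin

definition gauss_measure :: "(real ^ 'n) measure" where
  "gauss_measure = density lborel
     (\<lambda>x. ennreal ((2 * pi) powr (- real CARD('n) / 2) * exp (- (norm x)\<^sup>2 / 2)))"

definition symmetric_set :: "(real ^ 'n) set \<Rightarrow> bool" where
  "symmetric_set A \<longleftrightarrow> A = uminus ` A"

text \<open>The closed form of the radius \<open>\<rho>\<^sub>n\<close>, as a sequence in \<open>n\<close>; its value at
  \<open>n = 0\<close> is irrelevant.\<close>
definition gauss_radius :: "nat \<Rightarrow> real" where
  "gauss_radius n = 1 / sqrt 2 * Gamma (1 + real n / 2) powr (1 / real n)"

end

theory Submission
  imports Defs "HOL-Real_Asymp.Real_Asymp"
begin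

text \<open>
  Substituting \<open>x = a + b\<close>, \<open>y = a - b\<close> turns \<open>\<mu>(A) \<mu>(B)\<close> into
  \<open>(2 \<pi>)\<^sup>-\<^sup>n 2\<^sup>n \<integral> exp (- |b|\<^sup>2) F(b) db\<close> with
  \<open>F(b) = \<integral> 1\<^sub>A(a + b) 1\<^sub>B(a - b) exp (- |a|\<^sup>2) da\<close>. Since \<open>F\<close> is even, the midpoint case of the
  Prekopa-Leindler inequality gives \<open>F(b) \<le> F(0) \<le> (2 \<pi>)\<^bsup>n/2\<^esup> \<mu>(A \<inter> B)\<close>. Moreover \<open>F(b) = 0\<close> unless
  \<open>|b| \<le> \<rho>\<close>, so the integral over \<open>b\<close> contributes at most the volume of the ball of radius \<open>\<rho>\<close>, and
  \<open>2\<^sup>n\<close> times this volume is \<open>(2 \<pi>)\<^bsup>n/2\<^esup>\<close>. The Prekopa-Leindler inequality is proved by induction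
  on the dimension from the Brunn-Minkowski inequality on the line.
\<close>

subsection \<open>The Prekopa-Leindler inequality\<close>

lemma brunn_minkowski_real_bounded:
  fixes A B C :: "real set"
  assumes [measurable]: "A \<in> sets borel" "B \<in> sets borel" "C \<in> sets borel"
    and ne: "A \<noteq> {}" "B \<noteq> {}" and bdd: "bdd_above A" "bdd_below B"
    and mid: "\<And>x y. x \<in> A \<Longrightarrow> y \<in> B \<Longrightarrow> (x + y) / 2 \<in> C"
  shows "emeasure lborel A + emeasure lborel B \<le> 2 * emeasure lborel C"
proof (rule ennreal_le_epsilon)
  fix e :: real assume e: "0 < e"
  obtain x where x: "x \<in> A" "Sup A - e / 2 < x"
    using less_cSupD[of A "Sup A - e / 2"] ne e by auto
  obtain y where y: "y \<in> B" "y < Inf B + e / 2"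
    using cInf_lessD[of B "Inf B + e / 2"] ne e by auto
  txt \<open>The translates \<open>A + y\<close> and \<open>x + B\<close> both lie in \<open>2 C\<close>; as \<open>x\<close> is almost the supremum of \<open>A\<close>
    and \<open>y\<close> almost the infimum of \<open>B\<close>, they overlap in a short interval only.\<close>
  define A' where "A' = {z. z - y \<in> A}"
  define B' where "B' = {z. z - x \<in> B}"
  define C' where "C' = {z. z / 2 \<in> C}"
  have [measurable]: "A' \<in> sets borel" "B' \<in> sets borel" "C' \<in> sets borel"
    unfolding A'_def B'_def C'_def by measurable
  have affine: "emeasure lborel S = \<bar>c\<bar> * emeasure lborel {z. t + c * z \<in> S}"
    if [measurable]: "S \<in> sets borel" and "c \<noteq> 0" for S and c t :: real
  proof -
    have "emeasure lborel S = (\<integral>\<^sup>+z. indicator S z \<partial>lborel)"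
      by simp
    also have "\<dots> = \<bar>c\<bar> * (\<integral>\<^sup>+z. indicator S (t + c * z) \<partial>lborel)"
      by (rule nn_integral_real_affine) (use that in auto)
    also have "(\<integral>\<^sup>+z. indicator S (t + c * z) \<partial>lborel)
        = (\<integral>\<^sup>+z. indicator {z. t + c * z \<in> S} z \<partial>lborel)"
      by (intro nn_integral_cong) (auto split: split_indicator)
    also have "\<dots> = emeasure lborel {z. t + c * z \<in> S}"
      by (rule nn_integral_indicator) measurable
    finally show ?thesis .
  qed
  have mA: "emeasure lborel A' = emeasure lborel A"
    using affine[of A 1 "- y"] by (simp add: A'_def add.commute)
  have mB: "emeasure lborel B' = emeasure lborel B"
    using affine[of B 1 "- x"] by (simp add: B'_def add.commute)
  have mC: "emeasure lborel C' = 2 * emeasure lborel C"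
  proof -
    have "2 * emeasure lborel C = (ennreal 2 * ennreal (1 / 2)) * emeasure lborel C'"
      using affine[of C "1 / 2" 0] by (simp add: C'_def mult.assoc)
    also have "ennreal 2 * ennreal (1 / 2) = 1"
      by (subst ennreal_mult[symmetric]) auto
    finally show ?thesis by simp
  qed
  have "A' \<union> B' \<subseteq> C'"
    using mid[OF _ y(1)] mid[OF x(1)] by (fastforce simp: A'_def B'_def C'_def)
  moreover have "A' \<inter> B' \<subseteq> {x + y - e / 2..x + y + e / 2}"
    using cSup_upper[OF _ bdd(1)] cInf_lower[OF _ bdd(2)] x y
    by (fastforce simp: A'_def B'_def)
  ultimately have "emeasure lborel (A' \<union> B') + emeasure lborel (A' \<inter> B')
      \<le> emeasure lborel C' + emeasure lborel {x + y - e / 2..x + y + e / 2}"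
    by (intro add_mono emeasure_mono) auto
  then show "emeasure lborel A + emeasure lborel B \<le> 2 * emeasure lborel C + ennreal e"
    using e by (simp add: mA mB mC flip: emeasure_Un_Int)
qed

text \<open>Intersecting \<open>A\<close> and \<open>B\<close> with \<open>[-n, n]\<close> makes the
  one-sided bounds available and keeps all midpoints in the same \<open>C\<close>. Continuity of the
  measure from below then gives the limit. Both truncations are nonempty once \<open>n\<close>
  exceeds the absolute values of one chosen point of each set.\<close>

lemma brunn_minkowski_real:
  fixes A B C :: "real set"
  assumes [measurable]: "A \<in> sets borel" "B \<in> sets borel" "C \<in> sets borel"
    and ne: "A \<noteq> {}" "B \<noteq> {}"
    and mid: "\<And>x y. x \<in> A \<Longrightarrow> y \<in> B \<Longrightarrow> (x + y) / 2 \<in> C"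
  shows "emeasure lborel A + emeasure lborel B \<le> 2 * emeasure lborel C"
proof (rule LIMSEQ_le_const2)
  let ?I = "\<lambda>n::nat. {- real n..real n}"
  have "(\<lambda>n. emeasure lborel (S \<inter> ?I n)) \<longlonglongrightarrow> emeasure lborel S" if [measurable]: "S \<in> sets borel" for S
  proof -
    have "(\<Union>n. S \<inter> ?I n) = S"
      by (auto simp: abs_le_iff[symmetric] intro: real_arch_simple)
        (metis abs_le_iff real_arch_simple minus_le_iff)
    then show ?thesis
      using Lim_emeasure_incseq[of "\<lambda>n. S \<inter> ?I n" lborel] by (force simp: incseq_def)
  qed
  then show "(\<lambda>n. emeasure lborel (A \<inter> ?I n) + emeasure lborel (B \<inter> ?I n))
      \<longlonglongrightarrow> emeasure lborel A + emeasure lborel B"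
    by (intro tendsto_add) auto
  obtain a b where ab: "a \<in> A" "b \<in> B"
    using ne by auto
  obtain N where N: "max \<bar>a\<bar> \<bar>b\<bar> \<le> real N"
    using real_arch_simple by blast
  show "\<exists>N. \<forall>n\<ge>N. emeasure lborel (A \<inter> ?I n) + emeasure lborel (B \<inter> ?I n) \<le> 2 * emeasure lborel C"
  proof (intro exI[of _ N] allI impI brunn_minkowski_real_bounded)
    fix n assume n: "N \<le> n"
    then have n': "real N \<le> real n"
      by simp
    show "A \<inter> ?I n \<noteq> {}" "B \<inter> ?I n \<noteq> {}"
      using ab N n' by auto (fastforce simp: abs_le_iff)+
    show "bdd_above (A \<inter> ?I n)" "bdd_below (B \<inter> ?I n)"
      by (auto intro: bdd_above_Int2 bdd_below_Int2)
  qed (use mid in auto)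
qed

section \<open>From sets to functions on the line\<close>

text \<open>Each value \<open>y\<close> is the length of the set of real \<open>t > 0\<close> with
  \<open>ennreal t < y\<close>, also for \<open>y = \<infinity>\<close>; Tonelli then exchanges the
  integrals. The restriction to \<open>t > 0\<close> matters because \<open>ennreal\<close> sends
  negative reals to 0.\<close>

lemma (in sigma_finite_measure) nn_integral_layer_cake:
  assumes [measurable]: "f \<in> borel_measurable M"
  shows "(\<integral>\<^sup>+x. f x \<partial>M) = (\<integral>\<^sup>+t. indicator {0<..} t * emeasure M {x \<in> space M. ennreal t < f x} \<partial>lborel)"
proof -
  interpret lborel: sigma_finite_measure "lborel :: real measure"
    by (rule sigma_finite_lborel)
  interpret pair_sigma_finite M "lborel :: real measure" ..
  have layer: "(\<integral>\<^sup>+t. indicator {0<..} t * indicator {t. ennreal t < y} t \<partial>lborel) = y" for y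
  proof -
    have "(\<integral>\<^sup>+t. indicator {0<..} t * indicator {t. ennreal t < y} t \<partial>lborel)
        = (\<integral>\<^sup>+t. indicator {t. 0 < t \<and> ennreal t < y} t \<partial>lborel)"
      by (intro nn_integral_cong) (auto split: split_indicator)
    also have "\<dots> = emeasure lborel {t. 0 < t \<and> ennreal t < y}"
      by (rule nn_integral_indicator) measurable
    also have "\<dots> = y"
    proof (cases y)
      case (real r)
      then have "{t. 0 < t \<and> ennreal t < y} = {0<..<r}"
        by (auto simp: ennreal_less_iff)
      with real show ?thesis by simp
    next
      case top
      then have "{t. 0 < t \<and> ennreal t < y} = {0<..}" by auto
      moreover have "emeasure lborel {0::real<..} = \<infinity>"
      proof (rule ccontr)
        assume "emeasure lborel {0::real<..} \<noteq> \<infinity>"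
        then obtain n where "emeasure lborel {0::real<..} < of_nat n"
          using ennreal_Ex_less_of_nat by (auto simp: less_top)
        moreover have "emeasure lborel {0<..real n} \<le> emeasure lborel {0::real<..}"
          by (intro emeasure_mono) auto
        ultimately show False
          by (simp add: ennreal_of_nat_eq_real_of_nat)
      qed
      ultimately show ?thesis using top by simp
    qed
    finally show ?thesis .
  qed
  have "(\<integral>\<^sup>+x. f x \<partial>M) = (\<integral>\<^sup>+x. (\<integral>\<^sup>+t. indicator {0<..} t * indicator {t. ennreal t < f x} t \<partial>lborel) \<partial>M)"
    by (simp only: layer)
  also have "\<dots> = (\<integral>\<^sup>+t. (\<integral>\<^sup>+x. indicator {0<..} t * indicator {t. ennreal t < f x} t \<partial>M) \<partial>lborel)"
    by (rule Fubini'[symmetric]) measurable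
  also have "\<dots> = (\<integral>\<^sup>+t. indicator {0<..} t * emeasure M {x \<in> space M. ennreal t < f x} \<partial>lborel)"
    by (intro nn_integral_cong)
      (auto simp flip: nn_integral_indicator intro!: nn_integral_cong split: split_indicator)
  finally show ?thesis .
qed

text \<open>This is the arithmetic-geometric mean inequality. It turns the additive bound obtained
  for normalized functions into the multiplicative one.\<close>

lemma ennreal_mult_le_mean_power2:
  fixes u v w :: ennreal
  assumes "u + v \<le> 2 * w"
  shows "u * v \<le> w\<^sup>2"
proof (cases "w = \<infinity>")
  case False
  then have "2 * w < \<infinity>"
    by (simp add: ennreal_mult_less_top less_top)
  with assms have "u < \<infinity>" "v < \<infinity>"
    by (metis infinity_ennreal_def le_less_trans ennreal_add_less_top)+
  then obtain a b c where abc: "u = ennreal a" "v = ennreal b" "w = ennreal c" "a \<ge> 0" "b \<ge> 0" "c \<ge> 0"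
    using False by (cases u; cases v; cases w) auto
  with assms have "ennreal (a + b) \<le> ennreal (2 * c)"
    by (simp add: ennreal_mult)
  then have "a + b \<le> 2 * c"
    using abc by (subst (asm) ennreal_le_iff) auto
  then have "(a + b)\<^sup>2 \<le> (2 * c)\<^sup>2"
    using abc by (intro power_mono) auto
  moreover have "4 * (a * b) \<le> (a + b)\<^sup>2"
    using zero_le_power2[of "a - b"] by (simp add: power2_eq_square algebra_simps)
  ultimately have "a * b \<le> c\<^sup>2"
    by (simp add: power2_eq_square)
  with abc show ?thesis
    by (simp add: ennreal_leI power2_eq_square flip: ennreal_mult)
qed simp

text \<open>Equal suprema make the level sets of \<open>f\<close> and \<open>g\<close> nonempty for
  exactly the same positive levels. At such a level \<open>t\<close>, midpoints of the two sets lie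
  in the level set of \<open>h\<close>, since the hypothesis gives \<open>t^2 < h^2\<close> there.
  Brunn-Minkowski applies level by level, and the layer-cake formula sums up.\<close>

lemma prekopa_leindler_real_normalized:
  fixes f g h :: "real \<Rightarrow> ennreal"
  assumes [measurable]: "f \<in> borel_measurable borel" "g \<in> borel_measurable borel" "h \<in> borel_measurable borel"
    and fgh: "\<And>x y. f x * g y \<le> (h ((x + y) / 2))\<^sup>2"
    and f: "(SUP x. f x) = 1" and g: "(SUP x. g x) = 1"
  shows "(\<integral>\<^sup>+x. f x \<partial>lborel) + (\<integral>\<^sup>+x. g x \<partial>lborel) \<le> 2 * (\<integral>\<^sup>+x. h x \<partial>lborel)"
proof -
  interpret lborel: sigma_finite_measure "lborel :: real measure"
    by (rule sigma_finite_lborel)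
  let ?m = "\<lambda>k t. emeasure lborel {x::real. ennreal t < k x}"
  have "?m f t + ?m g t \<le> 2 * ?m h t" if t: "0 < t" for t
  proof (cases "t < 1")
    case True
    show ?thesis
    proof (rule brunn_minkowski_real)
      have "ennreal t < 1"
        using True t by (simp add: ennreal_less_one_iff)
      then show "{x. ennreal t < f x} \<noteq> {}" "{x. ennreal t < g x} \<noteq> {}"
        using less_SUP_iff[of "ennreal t" f UNIV] less_SUP_iff[of "ennreal t" g UNIV] f g by auto
      fix x y assume xy: "x \<in> {x. ennreal t < f x}" "y \<in> {x. ennreal t < g x}"
      have "(ennreal t)\<^sup>2 < f x * ennreal t"
        using xy t by (simp add: power2_eq_square ennreal_mult_strict_right_mono)
      also have "\<dots> \<le> f x * g y"
        using xy by (intro mult_left_mono) auto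
      also note fgh
      finally have "ennreal t < h ((x + y) / 2)"
        by (metis not_less power_mono zero_le)
      then show "(x + y) / 2 \<in> {x. ennreal t < h x}"
        by simp
    qed measurable
  next
    \<comment> \<open>The level sets are strict and both suprema are 1, so from \<open>t = 1\<close>
      on those of \<open>f\<close> and \<open>g\<close> are empty.\<close>
    case False
    then have "1 \<le> ennreal t"
      by simp
    moreover have "f x \<le> 1" "g x \<le> 1" for x
      using SUP_upper[of x UNIV f] SUP_upper[of x UNIV g] f g by auto
    ultimately have "f x \<le> ennreal t" "g x \<le> ennreal t" for x
      by (meson order_trans)+
    then have "{x. ennreal t < f x} = {}" "{x. ennreal t < g x} = {}"
      by (auto simp: not_less)
    then show ?thesis
      by (simp only: emeasure_empty) simp
  qed
  then have "(\<integral>\<^sup>+t. indicator {0<..} t * ?m f t + indicator {0<..} t * ?m g t \<partial>lborel)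
      \<le> (\<integral>\<^sup>+t. 2 * (indicator {0<..} t * ?m h t) \<partial>lborel)"
    by (intro nn_integral_mono) (auto split: split_indicator)
  then show ?thesis
    by (simp add: lborel.nn_integral_layer_cake[of f] lborel.nn_integral_layer_cake[of g]
        lborel.nn_integral_layer_cake[of h] nn_integral_add nn_integral_cmult)
qed

lemma prekopa_leindler_real:
  fixes f g h :: "real \<Rightarrow> ennreal"
  assumes [measurable]: "f \<in> borel_measurable borel" "g \<in> borel_measurable borel" "h \<in> borel_measurable borel"
    and fgh: "\<And>x y. f x * g y \<le> (h ((x + y) / 2))\<^sup>2"
  shows "(\<integral>\<^sup>+x. f x \<partial>lborel) * (\<integral>\<^sup>+x. g x \<partial>lborel) \<le> (\<integral>\<^sup>+x. h x \<partial>lborel)\<^sup>2"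
proof -
  have bounded: "(\<integral>\<^sup>+x. f x \<partial>lborel) * (\<integral>\<^sup>+x. g x \<partial>lborel) \<le> (\<integral>\<^sup>+x. h x \<partial>lborel)\<^sup>2"
    if [measurable]: "f \<in> borel_measurable borel" "g \<in> borel_measurable borel"
      and fgh: "\<And>x y. f x * g y \<le> (h ((x + y) / 2))\<^sup>2"
      and bdd: "(SUP x. f x) < \<infinity>" "(SUP x. g x) < \<infinity>" for f g :: "real \<Rightarrow> ennreal"
  proof (cases "(SUP x. f x) = 0 \<or> (SUP x. g x) = 0")
    case True
    then have "(\<forall>x. f x = 0) \<or> (\<forall>x. g x = 0)"
      by (metis SUP_upper UNIV_I le_zero_eq)
    then have "(\<integral>\<^sup>+x. f x \<partial>lborel) = 0 \<or> (\<integral>\<^sup>+x. g x \<partial>lborel) = 0"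
      by auto
    then show ?thesis by auto
  next
    case False
    obtain a b where ab: "(SUP x. f x) = ennreal a" "(SUP x. g x) = ennreal b" "a > 0" "b > 0"
      using bdd False by (cases "SUP x. f x"; cases "SUP x. g x") (auto simp: less_le)
    txt \<open>The weights satisfy \<open>p q = r\<^sup>2\<close>, so rescaling \<open>f\<close>, \<open>g\<close>, \<open>h\<close> by them keeps the
      hypothesis and makes both suprema \<open>1\<close>.\<close>
    define p q r where "p = ennreal (1 / a)" and "q = ennreal (1 / b)" and "r = ennreal (1 / sqrt (a * b))"
    have pqr: "p * q = r\<^sup>2"
      using ab by (simp add: p_def q_def r_def power_divide ennreal_power flip: ennreal_mult)
    have inv: "p * ennreal a = 1" "q * ennreal b = 1"
      using ab by (simp_all add: p_def q_def flip: ennreal_mult)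
    have "p * q * ((\<integral>\<^sup>+x. f x \<partial>lborel) * (\<integral>\<^sup>+x. g x \<partial>lborel))
        = (\<integral>\<^sup>+x. p * f x \<partial>lborel) * (\<integral>\<^sup>+x. q * g x \<partial>lborel)"
      by (simp add: nn_integral_cmult mult_ac)
    also have "\<dots> \<le> (\<integral>\<^sup>+x. r * h x \<partial>lborel)\<^sup>2"
    proof (rule ennreal_mult_le_mean_power2, rule prekopa_leindler_real_normalized)
      fix x y
      have "p * f x * (q * g y) = p * q * (f x * g y)"
        by (simp add: mult_ac)
      also have "\<dots> \<le> p * q * (h ((x + y) / 2))\<^sup>2"
        by (intro mult_left_mono fgh) auto
      finally show "p * f x * (q * g y) \<le> (r * h ((x + y) / 2))\<^sup>2"
        by (simp add: pqr power_mult_distrib)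
    qed (use ab inv in \<open>auto simp: SUP_mult_left_ennreal[symmetric]\<close>)
    also have "\<dots> = p * q * (\<integral>\<^sup>+x. h x \<partial>lborel)\<^sup>2"
      by (simp add: nn_integral_cmult power_mult_distrib pqr)
    finally show ?thesis
      using ab by (subst (asm) ennreal_mult_le_mult_iff) (auto simp: p_def q_def simp flip: ennreal_mult)
  qed
  \<comment> \<open>Unbounded functions are cut off at integer heights, which preserves the
    hypothesis with the same \<open>h\<close>. The heights \<open>n\<close> and \<open>m\<close>
    vary independently, so the product of the two suprema is bounded by bounding each product of
    truncated integrals.\<close>
  let ?t = "\<lambda>k n x. min (k x) (of_nat n :: ennreal)"
  have sup: "(\<integral>\<^sup>+x. k x \<partial>lborel) = (SUP n. \<integral>\<^sup>+x. ?t k n x \<partial>lborel)"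
    if [measurable]: "k \<in> borel_measurable borel" for k :: "real \<Rightarrow> ennreal"
  proof -
    have "(SUP n. ?t k n x) = k x" for x
      using inf_SUP[of "k x" "\<lambda>n. of_nat n :: ennreal" UNIV]
      by (simp add: inf_min ennreal_SUP_of_nat_eq_top)
    then have "(\<integral>\<^sup>+x. k x \<partial>lborel) = (\<integral>\<^sup>+x. (SUP n. ?t k n x) \<partial>lborel)"
      by simp
    also have "\<dots> = (SUP n. \<integral>\<^sup>+x. ?t k n x \<partial>lborel)"
      by (rule nn_integral_monotone_convergence_SUP)
        (auto simp: incseq_def le_fun_def intro: min.coboundedI2)
    finally show ?thesis .
  qed
  have "(\<integral>\<^sup>+x. ?t f n x \<partial>lborel) * (\<integral>\<^sup>+x. ?t g m x \<partial>lborel) \<le> (\<integral>\<^sup>+x. h x \<partial>lborel)\<^sup>2" for n m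
  proof (rule bounded)
    show "?t f n x * ?t g m y \<le> (h ((x + y) / 2))\<^sup>2" for x y
      by (rule order_trans[OF mult_mono fgh]) auto
    show "(SUP x. ?t f n x) < \<infinity>"
      by (rule le_less_trans[OF SUP_least[of _ _ "of_nat n"]]) (auto simp: of_nat_less_top)
    show "(SUP x. ?t g m x) < \<infinity>"
      by (rule le_less_trans[OF SUP_least[of _ _ "of_nat m"]]) (auto simp: of_nat_less_top)
  qed measurable
  then show ?thesis
    by (auto simp: sup[of f] sup[of g] SUP_mult_left_ennreal SUP_mult_right_ennreal intro!: SUP_least)
qed

section \<open>Prekopa-Leindler in higher dimension\<close>

text \<open>Fix coordinate \<open>i\<close> and integrate out the others: by the induction
  hypothesis, applied to slices at heights \<open>s\<close>, \<open>t\<close> and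
  \<open>(s + t) / 2\<close>, the slice integrals satisfy the hypothesis of the one-dimensional
  inequality. Over the empty index set the space is a single point, and the claim is the hypothesis
  there.\<close>

lemma prekopa_leindler_PiM:
  fixes f g h :: "('i \<Rightarrow> real) \<Rightarrow> ennreal"
  assumes "finite I"
    and "f \<in> borel_measurable (\<Pi>\<^sub>M i\<in>I. lborel)" "g \<in> borel_measurable (\<Pi>\<^sub>M i\<in>I. lborel)"
      "h \<in> borel_measurable (\<Pi>\<^sub>M i\<in>I. lborel)"
    and "\<And>x y. x \<in> extensional I \<Longrightarrow> y \<in> extensional I \<Longrightarrow> f x * g y \<le> (h (\<lambda>i\<in>I. (x i + y i) / 2))\<^sup>2"
  shows "(\<integral>\<^sup>+x. f x \<partial>(\<Pi>\<^sub>M i\<in>I. lborel)) * (\<integral>\<^sup>+x. g x \<partial>(\<Pi>\<^sub>M i\<in>I. lborel))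
    \<le> (\<integral>\<^sup>+x. h x \<partial>(\<Pi>\<^sub>M i\<in>I. lborel))\<^sup>2"
  using assms
proof (induction I arbitrary: f g h rule: finite_induct)
  case empty
  then show ?case
    by (simp add: PiM_empty nn_integral_count_space_finite restrict_def)
next
  case (insert i I)
  interpret product_sigma_finite "\<lambda>_::'i. lborel :: real measure" ..
  interpret I: finite_product_sigma_finite "\<lambda>_::'i. lborel :: real measure" I
    by standard (rule insert.hyps)
  note [measurable] = insert.prems(1-3)
  let ?N = "\<Pi>\<^sub>M i\<in>I. lborel :: real measure"
  let ?F = "\<lambda>k s. \<integral>\<^sup>+x. k (x(i := s)) \<partial>?N"
  have "(\<integral>\<^sup>+s. ?F f s \<partial>lborel) * (\<integral>\<^sup>+s. ?F g s \<partial>lborel) \<le> (\<integral>\<^sup>+s. ?F h s \<partial>lborel)\<^sup>2"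
  proof (rule prekopa_leindler_real)
    fix s t
    have [measurable]: "(\<lambda>x. x(i := r)) \<in> ?N \<rightarrow>\<^sub>M (\<Pi>\<^sub>M i\<in>insert i I. lborel)" for r :: real
      by (rule measurable_fun_upd[where J = I]) auto
    show "?F f s * ?F g t \<le> (?F h ((s + t) / 2))\<^sup>2"
    proof (rule insert.IH)
      fix x y :: "'i \<Rightarrow> real" assume xy: "x \<in> extensional I" "y \<in> extensional I"
      have "(\<lambda>j\<in>insert i I. ((x(i := s)) j + (y(i := t)) j) / 2) = (\<lambda>j\<in>I. (x j + y j) / 2)(i := (s + t) / 2)"
        using insert.hyps by (auto simp: fun_eq_iff)
      moreover have "x(i := s) \<in> extensional (insert i I)" "y(i := t) \<in> extensional (insert i I)"
        using xy by (auto simp: extensional_def)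
      ultimately show "f (x(i := s)) * g (y(i := t)) \<le> (h ((\<lambda>j\<in>I. (x j + y j) / 2)(i := (s + t) / 2)))\<^sup>2"
        using insert.prems(4) by metis
    qed measurable
  qed measurable
  then show ?case
    using insert.hyps by (simp add: product_nn_integral_insert_rev)
qed

theorem prekopa_leindler_midpoint:
  fixes f g h :: "'a::euclidean_space \<Rightarrow> ennreal"
  assumes [measurable]: "f \<in> borel_measurable borel" "g \<in> borel_measurable borel" "h \<in> borel_measurable borel"
    and fgh: "\<And>x y. f x * g y \<le> (h ((1 / 2) *\<^sub>R (x + y)))\<^sup>2"
  shows "(\<integral>\<^sup>+x. f x \<partial>lborel) * (\<integral>\<^sup>+x. g x \<partial>lborel) \<le> (\<integral>\<^sup>+x. h x \<partial>lborel)\<^sup>2"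
proof -
  let ?N = "\<Pi>\<^sub>M b\<in>(Basis :: 'a set). lborel :: real measure"
  let ?e = "\<lambda>x. \<Sum>b\<in>Basis. x b *\<^sub>R b :: 'a"
  have eq: "(\<integral>\<^sup>+x. k x \<partial>lborel) = (\<integral>\<^sup>+x. k (?e x) \<partial>?N)"
    if [measurable]: "k \<in> borel_measurable borel" for k :: "'a \<Rightarrow> ennreal"
    by (subst lborel_eq) (simp add: nn_integral_distr)
  have "(\<integral>\<^sup>+x. f (?e x) \<partial>?N) * (\<integral>\<^sup>+x. g (?e x) \<partial>?N) \<le> (\<integral>\<^sup>+x. h (?e x) \<partial>?N)\<^sup>2"
  proof (rule prekopa_leindler_PiM)
    fix x y :: "'a \<Rightarrow> real"
    have "?e (\<lambda>b\<in>Basis. (x b + y b) / 2) = (1 / 2) *\<^sub>R (?e x + ?e y)"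
      by (simp add: scaleR_sum_right flip: sum.distrib scaleR_add_left)
    with fgh[of "?e x" "?e y"] show "f (?e x) * g (?e y) \<le> (h (?e (\<lambda>b\<in>Basis. (x b + y b) / 2)))\<^sup>2"
      by simp
  qed simp_all
  then show ?thesis
    by (simp add: eq)
qed

subsection \<open>Correlation of symmetric convex sets\<close>

lemma nn_integral_lborel_affine:
  fixes f :: "'a::euclidean_space \<Rightarrow> ennreal"
  assumes [measurable]: "f \<in> borel_measurable borel" and c: "c \<noteq> 0"
  shows "(\<integral>\<^sup>+x. f x \<partial>lborel) = ennreal (\<bar>c\<bar> ^ DIM('a)) * (\<integral>\<^sup>+x. f (t + c *\<^sub>R x) \<partial>lborel)"
  by (subst lborel_affine[OF c, of t])
     (simp add: nn_integral_density nn_integral_distr nn_integral_cmult ennreal_power)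

lemma ennreal_power2_le_imp_le:
  fixes u v :: ennreal
  assumes "u\<^sup>2 \<le> v\<^sup>2"
  shows "u \<le> v"
proof (rule ccontr)
  assume "\<not> u \<le> v"
  then have less: "v < u" by simp
  then have "v < top"
    using top_greatest by (rule less_le_trans)
  have "v\<^sup>2 < u\<^sup>2"
  proof (cases "v = 0")
    case False
    then have "v * v < u * v"
      using less \<open>v < top\<close> by (intro ennreal_mult_strict_right_mono) (auto simp: zero_less_iff_neq_zero)
    also have "\<dots> \<le> u * u"
      using less by (intro mult_left_mono) auto
    finally show ?thesis by (simp add: power2_eq_square)
  qed (use less in \<open>simp add: power2_eq_square ennreal_zero_less_mult_iff\<close>)
  with assms show False by simp
qed

lemma nn_integral_overlap_le:
  fixes A B :: "'a::euclidean_space set"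
  assumes [measurable]: "A \<in> sets borel" "B \<in> sets borel"
    and convex: "convex A" "convex B"
    and sym: "\<And>x. x \<in> A \<Longrightarrow> - x \<in> A" "\<And>x. x \<in> B \<Longrightarrow> - x \<in> B"
  shows "(\<integral>\<^sup>+a. indicator A (a + b) * indicator B (a - b) * ennreal (exp (- (norm a)\<^sup>2)) \<partial>lborel)
    \<le> (\<integral>\<^sup>+a. indicator (A \<inter> B) a * ennreal (exp (- (norm a)\<^sup>2)) \<partial>lborel)"
    (is "?f \<le> ?h")
proof -
  txt \<open>By symmetry of \<open>A\<close> and \<open>B\<close>, the integrand and its reflection have the same integral, and
    the midpoints of their supports lie in \<open>A \<inter> B\<close>.\<close>
  let ?i = "\<lambda>a. indicator A (a + b) * indicator B (a - b) * ennreal (exp (- (norm a)\<^sup>2))"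
  have "?f = (\<integral>\<^sup>+a. ?i (- a) \<partial>lborel)"
    using nn_integral_lborel_affine[of ?i "- 1" 0] by simp
  moreover have "(\<integral>\<^sup>+a. ?i a \<partial>lborel) * (\<integral>\<^sup>+a. ?i (- a) \<partial>lborel) \<le> ?h\<^sup>2"
  proof (rule prekopa_leindler_midpoint)
    fix x y :: 'a
    let ?z = "(1 / 2) *\<^sub>R (x + y)"
    show "?i x * ?i (- y) \<le> (indicator (A \<inter> B) ?z * ennreal (exp (- (norm ?z)\<^sup>2)))\<^sup>2"
    proof (cases "x + b \<in> A \<and> x - b \<in> B \<and> - y + b \<in> A \<and> - y - b \<in> B")
      case True
      \<comment> \<open>Reflection sends \<open>- y + b\<close> to \<open>y - b\<close> and
        \<open>- y - b\<close> to \<open>y + b\<close>. The shifts by \<open>b\<close> then cancel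
        in the midpoints with \<open>x + b\<close> and \<open>x - b\<close>, leaving
        \<open>?z\<close> in both sets.\<close>
      then have "y - b \<in> A" "y + b \<in> B"
        using sym(1)[of "- y + b"] sym(2)[of "- y - b"] by (simp_all add: add.commute)
      then have "(1 / 2) *\<^sub>R (x + b) + (1 / 2) *\<^sub>R (y - b) \<in> A"
          "(1 / 2) *\<^sub>R (x - b) + (1 / 2) *\<^sub>R (y + b) \<in> B"
        using True by (intro convexD convex; simp)+
      then have z: "?z \<in> A \<inter> B"
        by (simp add: algebra_simps)
      \<comment> \<open>Midpoint convexity of the squared norm, which is the log-concavity of the
        Gaussian weight.\<close>
      have "2 * (norm ?z)\<^sup>2 \<le> (norm x)\<^sup>2 + (norm y)\<^sup>2"
      proof -
        have "0 \<le> (norm (x - y))\<^sup>2"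
          by simp
        then show ?thesis
          by (simp only: power2_norm_eq_inner) (simp add: algebra_simps inner_commute)
      qed
      then have "exp (- (norm x)\<^sup>2) * exp (- (norm y)\<^sup>2) \<le> (exp (- (norm ?z)\<^sup>2))\<^sup>2"
        by (simp flip: exp_add exp_double)
      then show ?thesis
        using True z by (simp add: ennreal_leI power2_eq_square flip: ennreal_mult)
    qed (auto simp: indicator_def)
  qed measurable
  ultimately have "?f\<^sup>2 \<le> ?h\<^sup>2"
    by (simp add: power2_eq_square)
  then show ?thesis
    by (rule ennreal_power2_le_imp_le)
qed

lemma nn_integral_gaussian_product_le:
  fixes A B :: "'a::euclidean_space set"
  assumes [measurable]: "A \<in> sets borel" "B \<in> sets borel"
    and convex: "convex A" "convex B"
    and sym: "\<And>x. x \<in> A \<Longrightarrow> - x \<in> A" "\<And>x. x \<in> B \<Longrightarrow> - x \<in> B"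
    and sub: "A \<subseteq> cball 0 \<rho>" "B \<subseteq> cball 0 \<rho>"
  defines "w \<equiv> \<lambda>x::'a. ennreal (exp (- (norm x)\<^sup>2 / 2))"
  shows "(\<integral>\<^sup>+x. indicator A x * w x \<partial>lborel) * (\<integral>\<^sup>+y. indicator B y * w y \<partial>lborel)
    \<le> 2 ^ DIM('a) * emeasure lborel (cball (0::'a) \<rho>) * (\<integral>\<^sup>+x. indicator (A \<inter> B) x * w x \<partial>lborel)"
    (is "?P \<le> _")
proof -
  interpret lborel_pair: pair_sigma_finite "lborel :: 'a measure" "lborel :: 'a measure" ..
  have [measurable]: "w \<in> borel_measurable borel"
    unfolding w_def by measurable
  let ?v = "\<lambda>a::'a. ennreal (exp (- (norm a)\<^sup>2))"
  let ?J = "\<lambda>b. \<integral>\<^sup>+a. indicator A (a + b) * indicator B (a - b) * ?v a \<partial>lborel"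
  let ?I = "\<lambda>S. \<integral>\<^sup>+x. indicator S x * w x \<partial>lborel"
  \<comment> \<open>The parallelogram law separates the variables \<open>a\<close> and
    \<open>b\<close>.\<close>
  have w: "w (a + b) * w (a - b) = ?v a * ?v b" for a b
  proof -
    have "(norm (a + b))\<^sup>2 + (norm (a - b))\<^sup>2 = 2 * (norm a)\<^sup>2 + 2 * (norm b)\<^sup>2"
      by (simp only: power2_norm_eq_inner) (simp add: algebra_simps inner_commute)
    then have "- (norm (a + b))\<^sup>2 / 2 + - (norm (a - b))\<^sup>2 / 2 = - (norm a)\<^sup>2 + - (norm b)\<^sup>2"
      by (simp add: field_simps)
    then show ?thesis
      by (simp add: w_def flip: ennreal_mult exp_add)
  qed
  have "?P = (\<integral>\<^sup>+x. indicator A x * w x * ?I B \<partial>lborel)"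
    by (simp add: nn_integral_multc)
  \<comment> \<open>The change of variables is done in two stages: \<open>y = x - 2 b\<close> for
    fixed \<open>x\<close>, which produces the factor \<open>2 ^ DIM('a)\<close>, and, after
    exchanging the integrals, the translation \<open>x = a + b\<close> for fixed \<open>b\<close>.
    Then \<open>y = a - b\<close>.\<close>
  also have "\<dots> = (\<integral>\<^sup>+x. indicator A x * w x *
      (2 ^ DIM('a) * (\<integral>\<^sup>+b. indicator B (x - 2 *\<^sub>R b) * w (x - 2 *\<^sub>R b) \<partial>lborel)) \<partial>lborel)"
  proof (rule nn_integral_cong)
    fix x
    have "?I B = 2 ^ DIM('a) * (\<integral>\<^sup>+b. indicator B (x - 2 *\<^sub>R b) * w (x - 2 *\<^sub>R b) \<partial>lborel)"
      using nn_integral_lborel_affine[of "\<lambda>y. indicator B y * w y" "- 2" x]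
      by (simp flip: ennreal_power)
    then show "indicator A x * w x * ?I B = indicator A x * w x *
      (2 ^ DIM('a) * (\<integral>\<^sup>+b. indicator B (x - 2 *\<^sub>R b) * w (x - 2 *\<^sub>R b) \<partial>lborel))"
      by simp
  qed
  also have "\<dots> = (\<integral>\<^sup>+x. (\<integral>\<^sup>+b. 2 ^ DIM('a) *
      (indicator A x * w x * (indicator B (x - 2 *\<^sub>R b) * w (x - 2 *\<^sub>R b))) \<partial>lborel) \<partial>lborel)"
    by (simp add: nn_integral_cmult mult_ac)
  also have "\<dots> = (\<integral>\<^sup>+b. (\<integral>\<^sup>+x. 2 ^ DIM('a) *
      (indicator A x * w x * (indicator B (x - 2 *\<^sub>R b) * w (x - 2 *\<^sub>R b))) \<partial>lborel) \<partial>lborel)"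
    by (rule lborel_pair.Fubini'[symmetric]) measurable
  also have "\<dots> = (\<integral>\<^sup>+b. 2 ^ DIM('a) * (?v b * ?J b) \<partial>lborel)"
  proof (rule nn_integral_cong)
    fix b :: 'a
    have "(\<integral>\<^sup>+x. indicator A x * w x * (indicator B (x - 2 *\<^sub>R b) * w (x - 2 *\<^sub>R b)) \<partial>lborel)
        = (\<integral>\<^sup>+a. indicator A (a + b) * w (a + b) * (indicator B (a - b) * w (a - b)) \<partial>lborel)"
      using nn_integral_lborel_affine[of
          "\<lambda>x. indicator A x * w x * (indicator B (x - 2 *\<^sub>R b) * w (x - 2 *\<^sub>R b))" 1 b]
      by (simp add: scaleR_2 algebra_simps)
    also have "\<dots> = (\<integral>\<^sup>+a. ?v b * (indicator A (a + b) * indicator B (a - b) * ?v a) \<partial>lborel)"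
    proof (rule nn_integral_cong)
      fix a
      have "indicator A (a + b) * w (a + b) * (indicator B (a - b) * w (a - b))
          = indicator A (a + b) * indicator B (a - b) * (w (a + b) * w (a - b))"
        by (simp only: mult_ac)
      then show "indicator A (a + b) * w (a + b) * (indicator B (a - b) * w (a - b))
          = ?v b * (indicator A (a + b) * indicator B (a - b) * ?v a)"
        unfolding w by (simp only: mult_ac)
    qed
    also have "\<dots> = ?v b * ?J b"
      by (rule nn_integral_cmult) measurable
    finally show "(\<integral>\<^sup>+x. 2 ^ DIM('a) *
        (indicator A x * w x * (indicator B (x - 2 *\<^sub>R b) * w (x - 2 *\<^sub>R b))) \<partial>lborel)
        = 2 ^ DIM('a) * (?v b * ?J b)"
      by (simp add: nn_integral_cmult)
  qed
  also have "\<dots> \<le> (\<integral>\<^sup>+b. 2 ^ DIM('a) * ?I (A \<inter> B) * indicator (cball 0 \<rho>) (b :: 'a) \<partial>lborel)"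
  proof (rule nn_integral_mono)
    fix b :: 'a
    have "?v b * ?J b \<le> ?I (A \<inter> B) * indicator (cball 0 \<rho>) b"
    proof (cases "b \<in> cball 0 \<rho>")
      case True
      have "?J b \<le> (\<integral>\<^sup>+a. indicator (A \<inter> B) a * ?v a \<partial>lborel)"
        by (intro nn_integral_overlap_le convex sym) auto
      \<comment> \<open>Here \<open>exp (- |a|^2)\<close> is replaced by the larger
        \<open>exp (- |a|^2 / 2)\<close>, returning to the weight \<open>w\<close>.\<close>
      also have "\<dots> \<le> ?I (A \<inter> B)"
        unfolding w_def by (intro nn_integral_mono mult_left_mono ennreal_leI) auto
      finally have "?v b * ?J b \<le> 1 * ?I (A \<inter> B)"
        by (intro mult_mono) auto
      with True show ?thesis by simp
    next
      \<comment> \<open>Points \<open>a + b\<close> and \<open>a - b\<close> of a ball of radius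
        \<rho> about the origin are at most \<open>2 \<rho>\<close> apart, and their difference is
        \<open>2 b\<close>. So no \<open>a\<close> contributes when
        \<open>|b| > \<rho>\<close>.\<close>
      case False
      have "indicator A (a + b) * indicator B (a - b) = (0 :: ennreal)" for a
      proof (rule ccontr)
        assume "indicator A (a + b) * indicator B (a - b) \<noteq> (0 :: ennreal)"
        then have "norm (a + b) \<le> \<rho>" "norm (a - b) \<le> \<rho>"
          using sub by (auto simp: indicator_def split: if_splits)
        moreover have "norm (2 *\<^sub>R b) \<le> norm (a + b) + norm (a - b)"
          using norm_triangle_ineq4[of "a + b" "a - b"] by (simp add: scaleR_2)
        ultimately show False
          using False by simp
      qed
      then have "?J b = 0"
        by (simp only: mult_zero_left) simp
      then show ?thesis by simp
    qed
    then show "2 ^ DIM('a) * (?v b * ?J b) \<le> 2 ^ DIM('a) * ?I (A \<inter> B) * indicator (cball 0 \<rho>) b"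
      by (simp add: mult.assoc mult_left_mono)
  qed
  also have "\<dots> = 2 ^ DIM('a) * emeasure lborel (cball (0::'a) \<rho>) * ?I (A \<inter> B)"
    by (subst nn_integral_cmult_indicator) (auto simp: mult_ac borel_closed)
  finally show ?thesis .
qed

lemma gauss_measure_correlation:
  fixes A B :: "(real ^ 'n) set"
  assumes [measurable]: "A \<in> sets borel" "B \<in> sets borel"
    and convex: "convex A" "convex B" and sym: "symmetric_set A" "symmetric_set B"
    and sub: "A \<subseteq> cball 0 \<rho>" "B \<subseteq> cball 0 \<rho>" and "\<rho> > 0"
    and vol: "measure lborel (cball (0 :: real ^ 'n) (2 * \<rho>)) \<le> (2 * pi) powr (real CARD('n) / 2)"
  shows "measure gauss_measure A * measure gauss_measure B \<le> measure gauss_measure (A \<inter> B)"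
proof -
  define w :: "real ^ 'n \<Rightarrow> ennreal" where "w = (\<lambda>x. ennreal (exp (- (norm x)\<^sup>2 / 2)))"
  define c where "c = ennreal ((2 * pi) powr (- real CARD('n) / 2))"
  have [measurable]: "w \<in> borel_measurable borel"
    unfolding w_def by measurable
  let ?I = "\<lambda>S. \<integral>\<^sup>+x. indicator S x * w x \<partial>lborel"
  have gauss: "emeasure gauss_measure S = c * ?I S" if [measurable]: "S \<in> sets borel" for S :: "(real ^ 'n) set"
  proof -
    have "emeasure gauss_measure S = (\<integral>\<^sup>+x. c * (indicator S x * w x) \<partial>lborel)"
      by (simp add: gauss_measure_def emeasure_density c_def w_def ennreal_mult mult_ac)
    also have "\<dots> = c * ?I S"
      by (rule nn_integral_cmult) measurable
    finally show ?thesis .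
  qed
  \<comment> \<open>\<open>measure\<close> sends infinite mass to 0, so finiteness is secured before
    leaving \<open>emeasure\<close>. Since \<open>w \<le> 1\<close>, the volume of the ball bounds
    the integral.\<close>
  have finite: "emeasure gauss_measure S < \<infinity>" if [measurable]: "S \<in> sets borel" and "S \<subseteq> cball 0 \<rho>" for S :: "(real ^ 'n) set"
  proof -
    have "?I S \<le> (\<integral>\<^sup>+x. indicator (cball 0 \<rho>) (x :: real ^ 'n) \<partial>lborel)"
      using that by (intro nn_integral_mono) (auto simp: w_def indicator_def)
    also have "\<dots> < \<infinity>"
      using emeasure_lborel_cball_finite[of "0 :: real ^ 'n" \<rho>] by simp
    finally show ?thesis
      by (simp add: gauss c_def ennreal_mult_less_top)
  qed
  \<comment> \<open>The Jacobian factor doubles the radius. The volume bound for the doubled ball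
    then absorbs one of the two normalizing constants \<open>c\<close> in the product of the
    measures; the other belongs to the measure of \<open>A \<inter> B\<close>.\<close>
  have "2 ^ CARD('n) * emeasure lborel (cball (0 :: real ^ 'n) \<rho>) = emeasure lborel (cball (0 :: real ^ 'n) (2 * \<rho>))"
  proof -
    have "2 ^ CARD('n) = ennreal (2 ^ CARD('n))"
      by (simp flip: ennreal_power)
    with \<open>\<rho> > 0\<close> show ?thesis
      by (simp add: emeasure_cball power_mult_distrib mult_ac flip: ennreal_mult)
  qed
  also have "\<dots> \<le> ennreal ((2 * pi) powr (real CARD('n) / 2))"
    using vol emeasure_lborel_cball_finite[of "0 :: real ^ 'n" "2 * \<rho>"]
    by (simp add: emeasure_eq_ennreal_measure less_top ennreal_leI)
  finally have "c * (2 ^ CARD('n) * emeasure lborel (cball (0 :: real ^ 'n) \<rho>))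
      \<le> c * ennreal ((2 * pi) powr (real CARD('n) / 2))"
    by (rule mult_left_mono) simp
  also have "\<dots> = 1"
    by (simp add: c_def flip: ennreal_mult powr_add)
  finally have c: "c * (2 ^ CARD('n) * emeasure lborel (cball (0 :: real ^ 'n) \<rho>)) \<le> 1" .
  have neg: "- x \<in> S" if "symmetric_set S" "x \<in> S" for S and x :: "real ^ 'n"
    using that by (auto simp: symmetric_set_def)
  have "emeasure gauss_measure A * emeasure gauss_measure B = c * c * (?I A * ?I B)"
    by (simp add: gauss mult_ac)
  also have "\<dots> \<le> c * c * (2 ^ CARD('n) * emeasure lborel (cball (0 :: real ^ 'n) \<rho>) * ?I (A \<inter> B))"
    using nn_integral_gaussian_product_le[OF assms(1,2) convex neg[OF sym(1)] neg[OF sym(2)] sub]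
    by (intro mult_left_mono) (simp_all add: w_def)
  also have "\<dots> = c * (2 ^ CARD('n) * emeasure lborel (cball (0 :: real ^ 'n) \<rho>)) * emeasure gauss_measure (A \<inter> B)"
    by (simp add: gauss mult_ac)
  also have "\<dots> \<le> 1 * emeasure gauss_measure (A \<inter> B)"
    by (rule mult_right_mono[OF c]) simp
  finally have "emeasure gauss_measure A * emeasure gauss_measure B \<le> emeasure gauss_measure (A \<inter> B)"
    by simp
  moreover have "emeasure gauss_measure S = ennreal (measure gauss_measure S)"
    if "S \<in> sets borel" "S \<subseteq> cball 0 \<rho>" for S :: "(real ^ 'n) set"
    using finite[OF that] by (simp add: emeasure_eq_ennreal_measure less_top)
  moreover have "A \<inter> B \<subseteq> cball 0 \<rho>"
    using sub by auto
  ultimately show ?thesis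
    using sub by (simp flip: ennreal_mult)
qed

subsection \<open>The radius\<close>

text \<open>The function \<open>d\<close> is the error of Stirling's approximation \<open>ln \<Gamma>(1 + x) \<approx> x ln x - x\<close>.\<close>

lemma ln_Gamma_stirling_step:
  fixes x :: real
  defines "d \<equiv> \<lambda>x. ln (Gamma (1 + x)) - (x * ln x - x)"
  assumes x: "x > 0"
  shows "0 \<le> d (x + 1) - d x" "d (x + 1) - d x \<le> ln (x + 1) - ln x"
proof -
  have "Gamma (1 + (x + 1)) = (1 + x) * Gamma (1 + x)"
    using Gamma_plus1[of "1 + x"] x nonpos_Ints_nonpos[of "1 + x"] by (force simp: algebra_simps)
  then have "ln (Gamma (1 + (x + 1))) = ln (x + 1) + ln (Gamma (1 + x))"
    using x Gamma_real_pos[of "1 + x"] by (simp add: ln_mult add.commute del: Gamma_real_pos)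
  \<comment> \<open>With this formula the two claims amount to
    \<open>1 / (x + 1) \<le> ln (x + 1) - ln x \<le> 1 / x\<close>.\<close>
  then have eq: "d (x + 1) - d x = 1 - x * (ln (x + 1) - ln x)"
    by (simp add: d_def algebra_simps)
  have "ln (x + 1) - ln x = ln (1 + 1 / x)"
    using x ln_div[of "x + 1" x] by (simp add: add_divide_distrib)
  also have "\<dots> \<le> 1 / x"
    using x by (intro ln_add_one_self_le_self) auto
  finally have "x * (ln (x + 1) - ln x) \<le> 1"
    using x by (simp add: field_simps)
  then show "0 \<le> d (x + 1) - d x"
    using eq by simp
  have "ln x - ln (x + 1) = ln (x / (x + 1))"
    using x by (simp add: ln_div)
  also have "\<dots> \<le> x / (x + 1) - 1"
    using x by (intro ln_le_minus_one) auto
  also have "\<dots> = - 1 / (x + 1)"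
    using x by (simp add: field_simps)
  finally have "(x + 1) * (ln (x + 1) - ln x) \<ge> 1"
    using x by (simp add: field_simps)
  then show "d (x + 1) - d x \<le> ln (x + 1) - ln x"
    using eq by (simp add: algebra_simps)
qed

text \<open>Replacing \<open>n\<close> by \<open>n + 2\<close> moves the argument
  \<open>n / 2\<close> by 1. Along such steps \<open>d\<close> does not decrease and
  \<open>d - ln\<close> does not increase, so the extreme values at the two starting points
  \<open>1 / 2\<close> and \<open>1\<close> serve as bounds; the second carries no logarithm because
  \<open>ln 1 = 0\<close>.\<close>

lemma ln_Gamma_half_bounds:
  fixes d :: "real \<Rightarrow> real" and n :: nat
  defines "d \<equiv> \<lambda>x. ln (Gamma (1 + x)) - (x * ln x - x)"
  assumes "n \<ge> 1"
  shows "min (d (1 / 2)) (d 1) \<le> d (real n / 2)"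
    and "d (real n / 2) \<le> max (d (1 / 2) - ln (1 / 2)) (d 1) + ln (real n / 2)"
proof -
  let ?l = "min (d (1 / 2)) (d 1)" and ?u = "max (d (1 / 2) - ln (1 / 2)) (d 1)"
  have step: "0 \<le> d (x + 1) - d x" "d (x + 1) - d x \<le> ln (x + 1) - ln x" if "x > 0" for x
    using ln_Gamma_stirling_step[OF that] by (auto simp: d_def)
  have "?l \<le> d (real n / 2) \<and> d (real n / 2) \<le> ?u + ln (real n / 2)"
    using \<open>n \<ge> 1\<close>
  proof (induction n rule: less_induct)
    case (less n)
    consider "n = 1" | "n = 2" | m where "n = m + 2" "m \<ge> 1"
      using less.prems by (metis One_nat_def add_2_eq_Suc' le_antisym not_less_eq_eq
          nat_le_linear numeral_2_eq_2 old.nat.exhaust Suc_le_mono le0)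
    then show ?case
    proof cases
      case 3
      then have "real n / 2 = real m / 2 + 1"
        by (simp add: field_simps)
      with step[of "real m / 2"] less.IH[of m] 3 show ?thesis
        unfolding \<open>real n / 2 = real m / 2 + 1\<close> by simp
    qed auto
  qed
  then show "?l \<le> d (real n / 2)" "d (real n / 2) \<le> ?u + ln (real n / 2)"
    by auto
qed

text \<open>The quotient of the two sides is exactly \<open>exp (d (n / 2) / n)\<close> for
  \<open>n \<ge> 1\<close>. The error \<open>d (n / 2)\<close> grows at most logarithmically and is
  bounded below, so the exponent tends to 0.\<close>

lemma gauss_radius_asymp:
  "gauss_radius \<sim>[at_top] (\<lambda>n. 1 / 2 * sqrt (real n / exp 1))"
proof -
  define d where "d = (\<lambda>x::real. ln (Gamma (1 + x)) - (x * ln x - x))"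
  define l u where "l = min (d (1 / 2)) (d 1)" and "u = max (d (1 / 2) - ln (1 / 2)) (d 1)"
  have bounds: "l \<le> d (real n / 2)" "d (real n / 2) \<le> u + ln (real n / 2)" if "n \<ge> 1" for n :: nat
    using ln_Gamma_half_bounds[OF that] by (simp_all add: d_def l_def u_def)
  have "(\<lambda>n. d (real n / 2) / real n) \<longlonglongrightarrow> 0"
  proof (rule tendsto_sandwich)
    show "eventually (\<lambda>n. l / real n \<le> d (real n / 2) / real n) sequentially"
      "eventually (\<lambda>n. d (real n / 2) / real n \<le> (u + ln (real n / 2)) / real n) sequentially"
      using eventually_ge_at_top[of 1] by (eventually_elim, use bounds in \<open>simp add: divide_right_mono\<close>)+
    show "(\<lambda>n. l / real n) \<longlonglongrightarrow> 0" "(\<lambda>n. (u + ln (real n / 2)) / real n) \<longlonglongrightarrow> 0"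
      by real_asymp+
  qed
  then have "(\<lambda>n. exp (d (real n / 2) / real n)) \<longlonglongrightarrow> 1"
    using tendsto_exp[of _ 0] by fastforce
  moreover have "eventually (\<lambda>n. exp (d (real n / 2) / real n)
      = gauss_radius n / (1 / 2 * sqrt (real n / exp 1))) sequentially"
    using eventually_ge_at_top[of 1]
  proof eventually_elim
    case (elim n)
    have G: "Gamma (1 + real n / 2) > 0"
      by (intro Gamma_real_pos) (use elim in auto)
    have "gauss_radius n = exp (ln (Gamma (1 + real n / 2)) / real n - ln 2 / 2)"
      using less_imp_neq[OF G] elim by (simp add: gauss_radius_def powr_def exp_diff flip: ln_sqrt)
    moreover have "1 / 2 * sqrt (real n / exp 1) = exp ((ln (real n) - 1) / 2 - ln 2)"
    proof -
      have "sqrt (real n / exp 1) = exp (ln (sqrt (real n / exp 1)))"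
        using elim by simp
      also have "ln (sqrt (real n / exp 1)) = (ln (real n) - 1) / 2"
        using elim by (simp add: ln_sqrt ln_div)
      finally show ?thesis
        by (simp add: exp_diff)
    qed
    ultimately show ?case
      using elim by (simp flip: exp_diff add: d_def ln_div field_simps)
  qed
  ultimately show ?thesis
    by (intro asymp_equivI') (rule Lim_transform_eventually)
qed

text \<open>In the volume formula for the ball the powers of \<open>pi\<close> on both sides cancel.
  What remains is an equation for \<open>(2 * \<rho>) ^ n\<close>, whose positive
  \<open>n\<close>-th root gives the closed form.\<close>

lemma gauss_radius_unique:
  fixes \<rho> :: real
  assumes "\<rho> > 0"
    and "measure lborel (cball (0 :: real ^ 'n) (2 * \<rho>)) = (2 * pi) powr (real CARD('n) / 2)"
  shows "\<rho> = gauss_radius CARD('n)"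
proof -
  define n where "n = CARD('n)"
  have n: "n > 0" by (simp add: n_def)
  have G: "Gamma (1 + real n / 2) > 0"
    by (intro Gamma_real_pos) (use n in auto)
  have "pi powr (real n / 2) / Gamma (1 + real n / 2) * (2 * \<rho>) ^ n = (2 * pi) powr (real n / 2)"
    using assms content_cball[of "2 * \<rho>" "0 :: real ^ 'n"]
    by (simp add: unit_ball_vol_def n_def add.commute)
  then have "(2 * \<rho>) ^ n = 2 powr (real n / 2) * Gamma (1 + real n / 2)"
    using G by (simp add: powr_mult nonzero_divide_eq_eq less_imp_neq[symmetric] mult_ac)
  then have "((2 * \<rho>) powr real n) powr (1 / real n)
      = (2 powr (real n / 2) * Gamma (1 + real n / 2)) powr (1 / real n)"
    using assms by (simp add: powr_realpow)
  then have "2 * \<rho> = sqrt 2 * Gamma (1 + real n / 2) powr (1 / real n)"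
    using assms G n by (simp add: powr_powr powr_mult powr_half_sqrt)
  then have "\<rho> = sqrt 2 / 2 * Gamma (1 + real n / 2) powr (1 / real n)"
    by simp
  also have "sqrt 2 / 2 = 1 / sqrt (2::real)"
    by (simp add: real_div_sqrt field_simps)
  finally show ?thesis
    by (simp add: gauss_radius_def n_def)
qed

theorem corollary3:
  fixes \<rho> :: real
  assumes "\<rho> > 0"
    and "measure lborel (cball (0 :: real ^ 'n) (2 * \<rho>)) = (2 * pi) powr (real CARD('n) / 2)"
  shows "\<rho> = gauss_radius CARD('n) \<and>
         gauss_radius \<sim>[at_top] (\<lambda>n. 1 / 2 * sqrt (real n / exp 1)) \<and>
         (\<forall>A B :: (real ^ 'n) set.
            closed A \<and> convex A \<and> symmetric_set A \<and> A \<subseteq> cball 0 \<rho> \<and>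
            closed B \<and> convex B \<and> symmetric_set B \<and> B \<subseteq> cball 0 \<rho> \<longrightarrow>
            measure gauss_measure (A \<inter> B) \<ge> measure gauss_measure A * measure gauss_measure B)"
  using gauss_radius_unique[OF assms] gauss_radius_asymp assms
  by (auto intro!: gauss_measure_correlation borel_closed)

end
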